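(* For every positive integer $n$, the $n\times n$ rook graph $R_n$ is not (isomorphic to) the point graph of any strongly regular configuration.
   Context: The $n\times n$ rook graph $R_n$ has vertex set $\{(x,y): x,y\in\{1,\dots,n\}\}$, with distinct vertices $(x_1,y_1),(x_2,y_2)$ adjacent iff $x_1=x_2$ or $y_1=y_2$. A symmetric $(v_k)$ configuration is a finite incidence structure of $v$ points and $v$ lines such that every line has exactly $k$ points, every point lies on exactly $k$ lines, and two distinct points lie on at most one common line; throughout $k\ge 3$. Its point graph has the points as vertices, two distinct points adjacent iff they lie on a common line. A strongly regular configuration with parameters $(v_k;\lambda,\mu)$ is a symmetric $(v_k)$ configuration whose point graph is a strongly regular graph $SRG(v,k(k-1),\lambda,\mu)$. *)

theory Defs
  imports "Graph_Theory.Graph_Theory"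
begin

text \<open>
  A finite simple graph is a \<open>pair_graph\<close>: every undirected edge is represented by its two
  orientations in \<open>parcs\<close>, so the degree of a vertex is its \<open>out_degree\<close>.
\<close>

definition rook_graph :: "nat \<Rightarrow> (nat \<times> nat) pair_pre_digraph" where
  "rook_graph n =
     \<lparr> pverts = {1..n} \<times> {1..n},
       parcs = {(p, q). p \<in> {1..n} \<times> {1..n} \<and> q \<in> {1..n} \<times> {1..n} \<and> p \<noteq> q \<and>
                        (fst p = fst q \<or> snd p = snd q)} \<rparr>"

text \<open>
  No exclusion of complete, edgeless, disconnected or complete multipartite graphs is built in;
  for a complete (edgeless) graph the condition on \<open>\<mu>\<close> (on \<open>\<lambda>\<close>) is vacuous.
\<close>

locale strongly_regular_graph = pair_graph G for G :: "'a pair_pre_digraph" +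
  fixes v d lam mu :: nat
  assumes card_verts: "card (pverts G) = v"
    and regular: "x \<in> pverts G \<Longrightarrow> out_degree (with_proj G) x = d"
    and common_adjacent:
      "(x, y) \<in> parcs G \<Longrightarrow>
         card {z \<in> pverts G. (x, z) \<in> parcs G \<and> (y, z) \<in> parcs G} = lam"
    and common_nonadjacent:
      "\<lbrakk> x \<in> pverts G; y \<in> pverts G; x \<noteq> y; (x, y) \<notin> parcs G \<rbrakk> \<Longrightarrow>
         card {z \<in> pverts G. (x, z) \<in> parcs G \<and> (y, z) \<in> parcs G} = mu"

text \<open>
  Lines are abstract objects, not sets of points; \<open>inc p l\<close> means that \<open>p\<close> lies on \<open>l\<close>, and is
  only ever consulted for \<open>p \<in> P\<close> and \<open>l \<in> L\<close>.
\<close>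

locale symmetric_configuration =
  fixes P :: "'p set" and L :: "'l set" and inc :: "'p \<Rightarrow> 'l \<Rightarrow> bool" and v k :: nat
  assumes k_ge_3: "k \<ge> 3"
    and finite_points: "finite P"
    and finite_lines: "finite L"
    and card_points: "card P = v"
    and card_lines: "card L = v"
    and points_on_line: "l \<in> L \<Longrightarrow> card {p \<in> P. inc p l} = k"
    and lines_through_point: "p \<in> P \<Longrightarrow> card {l \<in> L. inc p l} = k"
    and at_most_one_line:
      "\<lbrakk> p \<in> P; q \<in> P; p \<noteq> q; l \<in> L; m \<in> L; inc p l; inc q l; inc p m; inc q m \<rbrakk> \<Longrightarrow> l = m"

definition point_graph :: "'p set \<Rightarrow> 'l set \<Rightarrow> ('p \<Rightarrow> 'l \<Rightarrow> bool) \<Rightarrow> 'p pair_pre_digraph" where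
  "point_graph P L inc =
     \<lparr> pverts = P,
       parcs = {(p, q). p \<in> P \<and> q \<in> P \<and> p \<noteq> q \<and> (\<exists>l\<in>L. inc p l \<and> inc q l)} \<rparr>"

locale strongly_regular_configuration =
  symmetric_configuration P L inc v k +
  strongly_regular_graph "point_graph P L inc" v "k * (k - 1)" lam mu
  for P :: "'p set" and L :: "'l set" and inc :: "'p \<Rightarrow> 'l \<Rightarrow> bool" and v k lam mu :: nat

lemma pair_graph_rook_graph: "pair_graph (rook_graph n)"
proof
  show "finite (parcs (rook_graph n))"
    by (rule finite_subset[of _ "({1..n} \<times> {1..n}) \<times> ({1..n} \<times> {1..n})"])
       (auto simp: rook_graph_def)
qed (auto simp: rook_graph_def symmetric_def sym_def)

lemma pair_graph_point_graph:
  assumes "finite P"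
  shows "pair_graph (point_graph P L inc)"
proof
  show "finite (parcs (point_graph P L inc))"
    by (rule finite_subset[of _ "P \<times> P"]) (auto simp: point_graph_def assms)
qed (auto simp: point_graph_def symmetric_def sym_def assms)

end

theory Submission
  imports Defs
begin

text \<open>
  Collinear points share a coordinate, so every line lies in a row or in a column. A line \<open>l\<close> inside
  a row must fill it: if \<open>q\<close> were a point of that row off \<open>l\<close>, the \<open>k\<close> lines joining \<open>q\<close> to the
  points of \<open>l\<close> would be all the lines through \<open>q\<close>, yet none of them contains another point of the
  column of \<open>q\<close>. Hence each point is on at most one line inside its row and at most one inside its
  column, so on at most two lines, whereas \<open>k \<ge> 3\<close>.
\<close>

text \<open>Rows and columns are labelled by one set \<open>S\<close> and enter the assumptions
  symmetrically, so each fact about rows also gives its column version by exchanging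
  \<open>row\<close> and \<open>col\<close>.\<close>

locale rook_configuration = symmetric_configuration P L inc v k
  for P :: "'p set" and L :: "'l set" and inc :: "'p \<Rightarrow> 'l \<Rightarrow> bool" and v k :: nat +
  fixes S :: "'a set" and row col :: "'p \<Rightarrow> 'a"
  assumes coordinates: "bij_betw (\<lambda>p. (row p, col p)) P (S \<times> S)"
    and collinear_iff:
      "\<lbrakk> p \<in> P; q \<in> P; p \<noteq> q \<rbrakk> \<Longrightarrow>
         (\<exists>l\<in>L. inc p l \<and> inc q l) \<longleftrightarrow> row p = row q \<or> col p = col q"
begin

lemma transposed: "rook_configuration P L inc v k S col row"
proof unfold_locales
  have "bij_betw prod.swap (S \<times> S) (S \<times> S)"
    by (rule bij_betwI[where g = prod.swap]) auto
  from bij_betw_trans[OF coordinates this]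
  show "bij_betw (\<lambda>p. (col p, row p)) P (S \<times> S)"
    by (simp add: o_def)
  show "(\<exists>l\<in>L. inc p l \<and> inc q l) \<longleftrightarrow> col p = col q \<or> row p = row q"
    if "p \<in> P" "q \<in> P" "p \<noteq> q" for p q
    by (simp add: collinear_iff[OF that] disj_commute)
qed

lemma eq_if_same_coordinates:
  "\<lbrakk> p \<in> P; q \<in> P; row p = row q; col p = col q \<rbrakk> \<Longrightarrow> p = q"
  using bij_betw_imp_inj_on[OF coordinates] by (auto simp: inj_on_def)

lemma coordinates_in:
  assumes "p \<in> P"
  shows "row p \<in> S" "col p \<in> S"
  using bij_betwE[OF coordinates] assms by auto

lemma ex_point_at:
  assumes "a \<in> S" "b \<in> S"
  obtains p where "p \<in> P" "row p = a" "col p = b"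
proof -
  have "(a, b) \<in> (\<lambda>p. (row p, col p)) ` P"
    using assms bij_betw_imp_surj_on[OF coordinates] by auto
  then show thesis using that by auto
qed

lemma line_has_other_point:
  assumes "l \<in> L"
  obtains q where "q \<in> P" "inc q l" "q \<noteq> p"
proof -
  have "\<not> {q \<in> P. inc q l} \<subseteq> {p}"
    using card_mono[of "{p}" "{q \<in> P. inc q l}"] points_on_line[OF assms] k_ge_3 by auto
  then show thesis using that by blast
qed

text \<open>If \<open>x\<close> on \<open>l\<close> left the row of \<open>p\<close> and
  \<open>y\<close> on \<open>l\<close> left its column, then \<open>x\<close> would lie in the
  column of \<open>p\<close> and \<open>y\<close> in its row, so \<open>x\<close> and
  \<open>y\<close> would share neither coordinate.\<close>

lemma line_in_row_or_column:
  assumes "l \<in> L" "p \<in> P" "inc p l"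
  shows "(\<forall>q\<in>P. inc q l \<longrightarrow> row q = row p) \<or> (\<forall>q\<in>P. inc q l \<longrightarrow> col q = col p)"
proof -
  have "row x = row y \<or> col x = col y" if "x \<in> P" "inc x l" "y \<in> P" "inc y l" for x y
    using collinear_iff[of x y] that assms(1) by blast
  then show ?thesis using assms(2,3) by metis
qed

lemma line_fills_row:
  assumes l: "l \<in> L" and l_row: "\<And>p. p \<in> P \<Longrightarrow> inc p l \<Longrightarrow> row p = row q"
    and q: "q \<in> P"
  shows "inc q l"
proof (rule ccontr)
  assume off: "\<not> inc q l"
  let ?X = "{x \<in> P. inc x l}" and ?M = "{m \<in> L. inc q m}"
  have "\<forall>x\<in>?X. \<exists>m. m \<in> L \<and> inc x m \<and> inc q m"
  proof
    fix x assume x: "x \<in> ?X"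
    then have "x \<noteq> q" "row x = row q" using l_row off by auto
    then show "\<exists>m. m \<in> L \<and> inc x m \<and> inc q m"
      using collinear_iff[of x q] x q by auto
  qed
  from bchoice[OF this] obtain g
    where g: "\<And>x. x \<in> ?X \<Longrightarrow> g x \<in> L \<and> inc x (g x) \<and> inc q (g x)"
    by blast
  \<comment> \<open>A line joining \<open>q\<close> to two points of \<open>l\<close> would be
    \<open>l\<close> itself, which misses \<open>q\<close>.\<close>
  have "inj_on g ?X"
  proof (rule inj_onI)
    fix x y assume xy: "x \<in> ?X" "y \<in> ?X" "g x = g y"
    show "x = y"
    proof (rule ccontr)
      assume "x \<noteq> y"
      then have "g x = l"
        using at_most_one_line[of x y "g x" l] g[OF xy(1)] g[OF xy(2)] xy l by auto
      then show False using g[OF xy(1)] off by simp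
    qed
  qed
  \<comment> \<open>Both sides equal \<open>k\<close>, so the joining lines exhaust the lines
    through \<open>q\<close>.\<close>
  then have "card (g ` ?X) = card ?M"
    by (simp add: card_image points_on_line[OF l] lines_through_point[OF q])
  moreover have "g ` ?X \<subseteq> ?M" using g by auto
  ultimately have surj: "g ` ?X = ?M"
    using finite_lines by (intro card_subset_eq) auto
  obtain x where x: "x \<in> P" "inc x l" "x \<noteq> q" by (rule line_has_other_point[OF l])
  then have "col x \<noteq> col q" using eq_if_same_coordinates[of x q] l_row[of x] q by auto
  \<comment> \<open>\<open>col x\<close> and \<open>col q\<close> are distinct elements of
    \<open>S\<close>, so one of them differs from \<open>row q\<close>; since \<open>S\<close> also
    labels the rows, it names a second row.\<close>
  then obtain b where b: "b \<in> S" "b \<noteq> row q"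
    using coordinates_in(2)[OF x(1)] coordinates_in(2)[OF q] by metis
  obtain q' where q': "q' \<in> P" "row q' = b" "col q' = col q"
    by (rule ex_point_at[OF b(1) coordinates_in(2)[OF q]])
  then obtain m where m: "m \<in> L" "inc q m" "inc q' m"
    using collinear_iff[of q q'] q b(2) by auto
  \<comment> \<open>The line \<open>m\<close> towards \<open>q'\<close> must also meet
    \<open>l\<close> in some \<open>y\<close>. As \<open>y\<close> and \<open>q'\<close> are in
    different rows, they share a column, which puts \<open>y\<close> at \<open>q\<close>.\<close>
  then have "m \<in> g ` ?X" by (simp add: surj)
  then obtain y where y: "y \<in> ?X" "m = g y" by blast
  then have "row y = row q" using l_row by simp
  moreover from this have "y \<noteq> q'" using q' b(2) by auto
  ultimately have "col y = col q"
    using collinear_iff[of y q'] y g[OF y(1)] m q' b(2) by auto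
  then have "y = q" using eq_if_same_coordinates[of y q] y \<open>row y = row q\<close> q by simp
  then show False using y off by simp
qed

text \<open>Both lines fill the row of \<open>p\<close>, so they share a second point.\<close>

lemma line_in_row_unique:
  assumes "p \<in> P" "l \<in> L" "inc p l" "m \<in> L" "inc p m"
    and l_row: "\<forall>q\<in>P. inc q l \<longrightarrow> row q = row p"
    and m_row: "\<forall>q\<in>P. inc q m \<longrightarrow> row q = row p"
  shows "l = m"
proof -
  obtain q where q: "q \<in> P" "inc q l" "q \<noteq> p" by (rule line_has_other_point[OF \<open>l \<in> L\<close>])
  then have "row q = row p" using l_row by simp
  then have "inc q m" using line_fills_row[OF \<open>m \<in> L\<close> _ q(1)] m_row by simp
  then show ?thesis using at_most_one_line[of p q l m] q assms(1-5) by simp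
qed

text \<open>The locale admits the empty configuration with \<open>S\<close> empty, so the
  contradiction has to start from a point.\<close>

lemma no_points: "P = {}"
proof (rule equals0I)
  fix p assume p: "p \<in> P"
  interpret transposed: rook_configuration P L inc v k S col row by (rule transposed)
  let ?R = "{l \<in> L. inc p l \<and> (\<forall>q\<in>P. inc q l \<longrightarrow> row q = row p)}"
  let ?C = "{l \<in> L. inc p l \<and> (\<forall>q\<in>P. inc q l \<longrightarrow> col q = col p)}"
  have "card ?R \<le> 1" "card ?C \<le> 1"
    using line_in_row_unique[OF p] transposed.line_in_row_unique[OF p] finite_lines
    by (auto simp: card_le_Suc0_iff_eq)
  moreover have "{l \<in> L. inc p l} = ?R \<union> ?C" using line_in_row_or_column p by blast
  ultimately have "k \<le> 2"
    using lines_through_point[OF p] card_Un_le[of ?R ?C] by simp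
  then show False using k_ge_3 by simp
qed

end

text \<open>A digraph isomorphism carries separate maps for vertices, arcs, tails and heads. For
  pair digraphs tail and head are \<open>fst\<close> and \<open>snd\<close>, which forces the arc
  map to be the one induced by the vertex map.\<close>

lemma digraph_iso_with_projE:
  assumes "digraph_iso (with_proj G) (with_proj H)"
  obtains f where "bij_betw f (pverts G) (pverts H)"
    and "\<And>x y. x \<in> pverts G \<Longrightarrow> y \<in> pverts G \<Longrightarrow> (f x, f y) \<in> parcs H \<longleftrightarrow> (x, y) \<in> parcs G"
proof -
  obtain h where h: "pre_digraph.digraph_isomorphism (with_proj G) h"
    and H: "with_proj H = app_iso h (with_proj G)"
    using assms by (auto simp: digraph_iso_def)
  let ?f = "iso_verts h"
  have wf: "wf_digraph (with_proj G)" and inj: "inj_on ?f (pverts G)"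
    using h by (auto simp: pre_digraph.digraph_isomorphism_def)
  have "iso_tail h = fst" "iso_head h = snd"
    using H by (metis tail_app_iso with_proj_simps(4), metis head_app_iso with_proj_simps(5))
  then have arc: "iso_arcs h (x, y) = (?f x, ?f y)" if "(x, y) \<in> parcs G" for x y
    using h that by (auto simp: pre_digraph.digraph_isomorphism_def prod_eq_iff)
  have parcs_H: "parcs H = iso_arcs h ` parcs G"
    using H by (metis arcs_app_iso with_proj_simps(2))
  have "pverts H = ?f ` pverts G"
    using H by (metis verts_app_iso with_proj_simps(1))
  then have "bij_betw ?f (pverts G) (pverts H)"
    using inj by (simp add: bij_betw_def)
  moreover have "(?f x, ?f y) \<in> parcs H \<longleftrightarrow> (x, y) \<in> parcs G"
    if xy: "x \<in> pverts G" "y \<in> pverts G" for x y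
  proof
    assume "(?f x, ?f y) \<in> parcs H"
    then obtain x' y' where x'y': "(x', y') \<in> parcs G" "?f x' = ?f x" "?f y' = ?f y"
      using arc by (auto simp: parcs_H)
    then have "x' \<in> pverts G" "y' \<in> pverts G"
      using wf_digraph.wellformed[OF wf, of "(x', y')"] by auto
    then show "(x, y) \<in> parcs G"
      using x'y' xy inj by (metis inj_onD)
  next
    assume "(x, y) \<in> parcs G"
    then show "(?f x, ?f y) \<in> parcs H"
      using arc[of x y] by (force simp: parcs_H)
  qed
  ultimately show thesis by (rule that)
qed

theorem theorem19:
  fixes n :: nat
  assumes "n \<ge> 1"
  shows "\<not> (\<exists>(P :: 'p set) (L :: 'l set) inc v k lam mu.
             strongly_regular_configuration P L inc v k lam mu \<and>
             digraph_iso (with_proj (rook_graph n)) (with_proj (point_graph P L inc)))"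
proof clarify
  fix P :: "'p set" and L :: "'l set" and inc v k lam mu
  assume "strongly_regular_configuration P L inc v k lam mu"
    and iso: "digraph_iso (with_proj (rook_graph n)) (with_proj (point_graph P L inc))"
  then interpret strongly_regular_configuration P L inc v k lam mu by simp
  let ?S = "{1..n}"
  have verts: "pverts (rook_graph n) = ?S \<times> ?S" "pverts (point_graph P L inc) = P"
    by (simp_all add: rook_graph_def point_graph_def)
  obtain f where f: "bij_betw f (?S \<times> ?S) P"
    and arcs: "\<And>x y. x \<in> ?S \<times> ?S \<Longrightarrow> y \<in> ?S \<times> ?S \<Longrightarrow>
      (f x, f y) \<in> parcs (point_graph P L inc) \<longleftrightarrow> (x, y) \<in> parcs (rook_graph n)"
    using digraph_iso_with_projE[OF iso] unfolding verts by metis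
  \<comment> \<open>The inverse of \<open>f\<close> reads off the grid coordinates of a
    point.\<close>
  define g where "g = the_inv_into (?S \<times> ?S) f"
  have g: "bij_betw g P (?S \<times> ?S)"
    unfolding g_def by (rule bij_betw_the_inv_into[OF f])
  have fg: "f (g p) = p" if "p \<in> P" for p
    unfolding g_def using f_the_inv_into_f_bij_betw[OF f] that by blast
  interpret rook_configuration P L inc v k ?S "fst \<circ> g" "snd \<circ> g"
  proof unfold_locales
    show "bij_betw (\<lambda>p. ((fst \<circ> g) p, (snd \<circ> g) p)) P (?S \<times> ?S)"
      using g by simp
    fix p q assume pq: "p \<in> P" "q \<in> P" "p \<noteq> q"
    have "(\<exists>l\<in>L. inc p l \<and> inc q l) \<longleftrightarrow> (f (g p), f (g q)) \<in> parcs (point_graph P L inc)"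
      using pq by (simp add: fg point_graph_def)
    also have "\<dots> \<longleftrightarrow> (g p, g q) \<in> parcs (rook_graph n)"
      using arcs bij_betwE[OF g] pq by blast
    \<comment> \<open>Adjacency in the rook graph also demands \<open>g p \<noteq> g q\<close>,
      which holds since \<open>f\<close> maps these back to \<open>p\<close> and
      \<open>q\<close>.\<close>
    also have "\<dots> \<longleftrightarrow> (fst \<circ> g) p = (fst \<circ> g) q \<or> (snd \<circ> g) p = (snd \<circ> g) q"
      using bij_betwE[OF g] pq fg unfolding rook_graph_def by (auto; metis)
    finally show "(\<exists>l\<in>L. inc p l \<and> inc q l) \<longleftrightarrow>
        (fst \<circ> g) p = (fst \<circ> g) q \<or> (snd \<circ> g) p = (snd \<circ> g) q" .
  qed
  \<comment> \<open>As \<open>n \<ge> 1\<close>, the grid has the cell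
    \<open>(1, 1)\<close>.\<close>
  have "f (1, 1) \<in> P" using bij_betwE[OF f] assms by auto
  then show False using no_points by simp
qed

end
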